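(* Let $I=[0,1]$ be equipped with an order-preserving metric $\varrho$ compatible with the Euclidean topology. Let $f\colon I\to I$ be continuous and let $x\in I$ be such that $\omega_f(x)$ is solenoidal, as witnessed by integers $2\le p_0<p_1<\dots$ and nondegenerate closed intervals $J_0\supseteq J_1\supseteq\dots$ in $I$. Then, for all $m\in\mathbb{N}$ and $\varepsilon>0$, $$\underline{c}_m(x,\varepsilon)=\overline{c}_m(x,\varepsilon),$$ i.e., the asymptotic correlation sum $c_m(x,\varepsilon)=\lim_{n\to\infty}C_m(x,n,\varepsilon)$ exists. Moreover, $$c_m(x,\varepsilon)=\lim_{t\to\infty}\frac{\#N_m^\circ(x,t,\varepsilon)}{p_t^2}=\lim_{t\to\infty}\frac{\#N_m(x,t,\varepsilon)}{p_t^2}.$$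
   Context: $\mathbb{N}=\{1,2,\dots\}$. A metric $\varrho$ on a real interval is order-preserving if $\max\{\varrho(x,y),\varrho(y,z)\}<\varrho(x,z)$ for all points $x<y<z$ of the interval. For $m\in\mathbb{N}$, Bowen's metric is $\varrho_m(x,y)=\max\{\varrho(f^i(x),f^i(y)):0\le i<m\}$. For $x\in I$, $n\in\mathbb{N}$, $\varepsilon>0$, the correlation sum is $$C_m(x,n,\varepsilon)=\frac1{n^2}\#\{(i,j):0\le i,j<n,\ \varrho_m(f^i(x),f^j(x))\le\varepsilon\},$$ and $\underline{c}_m(x,\varepsilon)=\liminf_{n\to\infty}C_m(x,n,\varepsilon)$, $\overline{c}_m(x,\varepsilon)=\limsup_{n\to\infty}C_m(x,n,\varepsilon)$. $\omega_f(x)$ is the set of all limit points of the trajectory $(f^n(x))_{n\ge0}$. A compact interval $J\subseteq I$ is $p$-periodic ($p\in\mathbb{N}$) if $f^p(J)=J$ and $f^k(J)$, $0\le k<p$, are pairwise disjoint. The set $\omega_f(x)$ is solenoidal, as witnessed by integers $2\le p_0<p_1<\dots$ and nondegenerate closed intervals $J_0\supseteq J_1\supseteq\dots$ in $I$, if every $J_t$ is $p_t$-periodic and $\omega_f(x)\subseteq\bigcap_{t\ge0}\bigsqcup_{i=0}^{p_t-1}f^i(J_t)$. For compact intervals $J,K$, let $\operatorname{dist}(J,K)=\min\{\varrho(u,v):u\in J,\ v\in K\}$ and $\operatorname{diam}(J\cup K)=\max\{\varrho(u,v):u,v\in J\cup K\}$. For $t\ge0$ and $a\in\{0,1,\dots,p_t-1\}$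 put $K_a=f^a(J_t)$, with the index $a$ read modulo $p_t$ (consistent since $f^{p_t}(J_t)=J_t$). For $m\in\mathbb{N}$ and $a,b\in\{0,\dots,p_t-1\}$ put $$\operatorname{dist}_m(K_a,K_b)=\max_{0\le i<m}\operatorname{dist}(K_{a+i},K_{b+i}),\qquad \operatorname{diam}_m(K_a,K_b)=\max_{0\le i<m}\operatorname{diam}(K_{a+i}\cup K_{b+i}).$$ Finally, $$N_m(x,t,\varepsilon)=\{(a,b)\in\{0,\dots,p_t-1\}^2:\operatorname{dist}_m(K_a,K_b)<\varepsilon\},$$ $$N_m^\circ(x,t,\varepsilon)=\{(a,b)\in\{0,\dots,p_t-1\}^2:\operatorname{diam}_m(K_a,K_b)\le\varepsilon\}.$$ *)

theory Defs
  imports "HOL-Analysis.Analysis"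
begin

definition order_preserving_metric :: "real set \<Rightarrow> (real \<Rightarrow> real \<Rightarrow> real) \<Rightarrow> bool" where
  "order_preserving_metric I \<rho> \<longleftrightarrow>
     Metric_space I \<rho> \<and>
     (\<forall>x\<in>I. \<forall>y\<in>I. \<forall>z\<in>I. x < y \<and> y < z \<longrightarrow> max (\<rho> x y) (\<rho> y z) < \<rho> x z)"

definition compatible_metric :: "real set \<Rightarrow> (real \<Rightarrow> real \<Rightarrow> real) \<Rightarrow> bool" where
  "compatible_metric I \<rho> \<longleftrightarrow> Metric_space I \<rho> \<and> Metric_space.mtopology I \<rho> = top_of_set I"

definition bowen_metric ::
    "(real \<Rightarrow> real \<Rightarrow> real) \<Rightarrow> (real \<Rightarrow> real) \<Rightarrow> nat \<Rightarrow> real \<Rightarrow> real \<Rightarrow> real" where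
  "bowen_metric \<rho> f m x y = Max ((\<lambda>i. \<rho> ((f ^^ i) x) ((f ^^ i) y)) ` {..<m})"

definition corr_sum ::
    "(real \<Rightarrow> real \<Rightarrow> real) \<Rightarrow> (real \<Rightarrow> real) \<Rightarrow> nat \<Rightarrow> real \<Rightarrow> real \<Rightarrow> nat \<Rightarrow> real" where
  "corr_sum \<rho> f m x \<epsilon> n =
     real (card {(i, j). i < n \<and> j < n \<and> bowen_metric \<rho> f m ((f ^^ i) x) ((f ^^ j) x) \<le> \<epsilon>})
       / (real n)\<^sup>2"

(* The lower and upper limits are taken in ereal because Liminf and Limsup need a
   complete lattice; the correlation sums themselves lie in [0,1]. *)

definition lower_corr ::
    "(real \<Rightarrow> real \<Rightarrow> real) \<Rightarrow> (real \<Rightarrow> real) \<Rightarrow> nat \<Rightarrow> real \<Rightarrow> real \<Rightarrow> ereal" where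
  "lower_corr \<rho> f m x \<epsilon> = liminf (\<lambda>n. ereal (corr_sum \<rho> f m x \<epsilon> n))"

definition upper_corr ::
    "(real \<Rightarrow> real \<Rightarrow> real) \<Rightarrow> (real \<Rightarrow> real) \<Rightarrow> nat \<Rightarrow> real \<Rightarrow> real \<Rightarrow> ereal" where
  "upper_corr \<rho> f m x \<epsilon> = limsup (\<lambda>n. ereal (corr_sum \<rho> f m x \<epsilon> n))"

(* Limits of subsequences of the trajectory, so a point visited infinitely often
   belongs to the set even if it is isolated in the orbit. *)

definition omega_limit_set :: "(real \<Rightarrow> real) \<Rightarrow> real \<Rightarrow> real set" where
  "omega_limit_set f x = {y. \<exists>r. strict_mono r \<and> (\<lambda>n. (f ^^ (r n)) x) \<longlonglongrightarrow> y}"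

definition periodic_interval :: "real set \<Rightarrow> (real \<Rightarrow> real) \<Rightarrow> nat \<Rightarrow> real set \<Rightarrow> bool" where
  "periodic_interval I f p J \<longleftrightarrow>
     1 \<le> p \<and> J \<subseteq> I \<and> (\<exists>a b. a \<le> b \<and> J = {a..b}) \<and>
     (f ^^ p) ` J = J \<and> disjoint_family_on (\<lambda>k. (f ^^ k) ` J) {..<p}"

definition solenoidal_witness ::
    "real set \<Rightarrow> (real \<Rightarrow> real) \<Rightarrow> real \<Rightarrow> (nat \<Rightarrow> nat) \<Rightarrow> (nat \<Rightarrow> real set) \<Rightarrow> bool" where
  "solenoidal_witness I f x p J \<longleftrightarrow>
     2 \<le> p 0 \<and> strict_mono p \<and>
     (\<forall>t. \<exists>a b. a < b \<and> J t = {a..b}) \<and>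
     (\<forall>t. J (Suc t) \<subseteq> J t) \<and>
     (\<forall>t. periodic_interval I f (p t) (J t)) \<and>
     omega_limit_set f x \<subseteq> (\<Inter>t. \<Union>i<p t. (f ^^ i) ` J t)"

(* For nonempty compact sets and a metric inducing the Euclidean topology, the infimum and
   supremum below are attained, so they are the minimum and maximum. *)

definition set_dist :: "(real \<Rightarrow> real \<Rightarrow> real) \<Rightarrow> real set \<Rightarrow> real set \<Rightarrow> real" where
  "set_dist \<rho> J K = Inf {\<rho> u v | u v. u \<in> J \<and> v \<in> K}"

definition set_diam :: "(real \<Rightarrow> real \<Rightarrow> real) \<Rightarrow> real set \<Rightarrow> real" where
  "set_diam \<rho> S = Sup {\<rho> u v | u v. u \<in> S \<and> v \<in> S}"

definition cycle_interval :: "(real \<Rightarrow> real) \<Rightarrow> nat \<Rightarrow> real set \<Rightarrow> nat \<Rightarrow> real set" where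
  "cycle_interval f q J a = (f ^^ (a mod q)) ` J"

definition dist_m ::
    "(real \<Rightarrow> real \<Rightarrow> real) \<Rightarrow> (real \<Rightarrow> real) \<Rightarrow> nat \<Rightarrow> real set \<Rightarrow> nat \<Rightarrow> nat \<Rightarrow> nat \<Rightarrow> real" where
  "dist_m \<rho> f q J m a b =
     Max ((\<lambda>i. set_dist \<rho> (cycle_interval f q J (a + i)) (cycle_interval f q J (b + i))) ` {..<m})"

definition diam_m ::
    "(real \<Rightarrow> real \<Rightarrow> real) \<Rightarrow> (real \<Rightarrow> real) \<Rightarrow> nat \<Rightarrow> real set \<Rightarrow> nat \<Rightarrow> nat \<Rightarrow> nat \<Rightarrow> real" where
  "diam_m \<rho> f q J m a b =
     Max ((\<lambda>i. set_diam \<rho> (cycle_interval f q J (a + i) \<union> cycle_interval f q J (b + i))) ` {..<m})"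

definition near_pairs ::
    "(real \<Rightarrow> real \<Rightarrow> real) \<Rightarrow> (real \<Rightarrow> real) \<Rightarrow> (nat \<Rightarrow> nat) \<Rightarrow> (nat \<Rightarrow> real set) \<Rightarrow>
      nat \<Rightarrow> nat \<Rightarrow> real \<Rightarrow> (nat \<times> nat) set" where
  "near_pairs \<rho> f p J m t \<epsilon> =
     {(a, b). a < p t \<and> b < p t \<and> dist_m \<rho> f (p t) (J t) m a b < \<epsilon>}"

definition inner_pairs ::
    "(real \<Rightarrow> real \<Rightarrow> real) \<Rightarrow> (real \<Rightarrow> real) \<Rightarrow> (nat \<Rightarrow> nat) \<Rightarrow> (nat \<Rightarrow> real set) \<Rightarrow>
      nat \<Rightarrow> nat \<Rightarrow> real \<Rightarrow> (nat \<times> nat) set" where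
  "inner_pairs \<rho> f p J m t \<epsilon> =
     {(a, b). a < p t \<and> b < p t \<and> diam_m \<rho> f (p t) (J t) m a b \<le> \<epsilon>}"

end

theory Submission
  imports Defs
begin

text \<open>The orbit eventually enters the \<open>t\<close>-th cycle and then visits its \<open>p t\<close> intervals in cyclic
  order, so the correlation sums are asymptotically squeezed between the proportion of pairs with
  \<open>diam_m \<le> \<epsilon>\<close> and the proportion of pairs with \<open>dist_m \<le> \<epsilon>\<close>. A pair counted by the second but
  not by the first yields, after some shift \<open>i < m\<close>, a critical pair: two intervals whose distance
  is at most \<open>\<epsilon>\<close> and whose union has diameter above \<open>\<epsilon>\<close>. As the metric preserves the order,
  critical pairs are never strictly nested, so there are at most \<open>5 * p t\<close> of them, and the two
  proportions differ by at most \<open>5 * m / p t\<close>.\<close>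

section \<open>Order-preserving metrics and intervals\<close>

text \<open>The interval from \<open>b\<close> to \<open>c\<close> is enlarged one endpoint at a
  time, each enlargement being one use of the three-point inequality. That inequality needs three
  distinct points, so \<open>b = c\<close> is treated apart, by positivity of the metric.\<close>

lemma order_preserving_metric_strict_mono:
  assumes "order_preserving_metric I \<rho>" "{a, b, c, d} \<subseteq> I" "a \<le> b" "b \<le> c" "c \<le> d" "a < b \<or> c < d"
  shows "\<rho> b c < \<rho> a d"
proof -
  have M: "Metric_space I \<rho>"
    and ord: "\<And>x y z. x \<in> I \<Longrightarrow> y \<in> I \<Longrightarrow> z \<in> I \<Longrightarrow> x < y \<Longrightarrow> y < z \<Longrightarrow> \<rho> x y < \<rho> x z \<and> \<rho> y z < \<rho> x z"
    using assms(1) unfolding order_preserving_metric_def by auto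
  interpret Metric_space I \<rho> by (rule M)
  have I: "a \<in> I" "b \<in> I" "c \<in> I" "d \<in> I" using assms(2) by auto
  show ?thesis
  proof (cases "b = c")
    case True
    have "a \<noteq> d" using assms by linarith
    then have "\<rho> a d \<noteq> 0" using I by simp
    then have "0 < \<rho> a d" using nonneg[of a d] by linarith
    then show ?thesis using True I by simp
  next
    case False
    then have "b < c" using assms by simp
    have 1: "\<rho> b c < \<rho> a c" if "a < b" using ord[of a b c] that \<open>b < c\<close> I by blast
    have 2: "\<rho> a c < \<rho> a d" if "c < d" using ord[of a c d] that \<open>b < c\<close> \<open>a \<le> b\<close> I by simp
    show ?thesis using 1 2 assms(3,5,6) by (metis order_le_less order_less_trans)
  qed
qed

lemma order_preserving_metric_mono:
  assumes "order_preserving_metric I \<rho>" "{a, b, c, d} \<subseteq> I" "a \<le> b" "b \<le> c" "c \<le> d"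
  shows "\<rho> b c \<le> \<rho> a d"
  using order_preserving_metric_strict_mono[OF assms] assms(3,5) by (cases "a < b \<or> c < d") auto

section \<open>Distances between sets and diameters\<close>

lemma set_dist_commute:
  assumes "Metric_space I \<rho>"
  shows "set_dist \<rho> A B = set_dist \<rho> B A"
proof -
  have "\<rho> u v = \<rho> v u" for u v using Metric_space.commute[OF assms] .
  then have "{\<rho> u v |u v. u \<in> A \<and> v \<in> B} = {\<rho> u v |u v. u \<in> B \<and> v \<in> A}" by blast
  then show ?thesis unfolding set_dist_def by simp
qed

lemma set_dist_le:
  assumes "Metric_space I \<rho>" "u \<in> A" "v \<in> B"
  shows "set_dist \<rho> A B \<le> \<rho> u v"
  unfolding set_dist_def
proof (rule cInf_lower)
  show "bdd_below {\<rho> u v |u v. u \<in> A \<and> v \<in> B}"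
    by (rule bdd_belowI[of _ 0]) (use Metric_space.nonneg[OF assms(1)] in auto)
qed (use assms in auto)

lemma set_dist_self:
  assumes "Metric_space I \<rho>" "u \<in> A" "A \<subseteq> I"
  shows "set_dist \<rho> A A = 0"
  unfolding set_dist_def
proof (rule cInf_eq_minimum)
  show "0 \<in> {\<rho> u v |u v. u \<in> A \<and> v \<in> A}"
    using assms Metric_space.zero[OF assms(1), of u u] by force
qed (use Metric_space.nonneg[OF assms(1)] in auto)

text \<open>The facing endpoints realise the infimum: moving either point away from the gap can only
  increase the distance, by monotonicity.\<close>

lemma set_dist_intervals:
  assumes "order_preserving_metric I \<rho>" "{a..d} \<subseteq> I" "a \<le> b" "b \<le> c" "c \<le> d"
  shows "set_dist \<rho> {a..b} {c..d} = \<rho> b c"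
  unfolding set_dist_def
proof (rule cInf_eq_minimum)
  show "\<rho> b c \<le> r" if "r \<in> {\<rho> u v |u v. u \<in> {a..b} \<and> v \<in> {c..d}}" for r
    using that assms by (auto intro!: order_preserving_metric_mono[OF assms(1)])
qed (use assms in auto)

lemma order_preserving_metric_le_endpoints:
  assumes "order_preserving_metric I \<rho>" "{a..b} \<subseteq> I" "u \<in> {a..b}" "v \<in> {a..b}"
  shows "\<rho> u v \<le> \<rho> a b"
proof -
  have "\<rho> u v = \<rho> v u"
    using assms(1) Metric_space.commute unfolding order_preserving_metric_def by metis
  moreover have "\<rho> u v \<le> \<rho> a b" if "u \<le> v"
    using that assms by (intro order_preserving_metric_mono[OF assms(1)]) auto
  moreover have "\<rho> v u \<le> \<rho> a b" if "v \<le> u"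
    using that assms by (intro order_preserving_metric_mono[OF assms(1)]) auto
  ultimately show ?thesis by linarith
qed

text \<open>\<open>S\<close> may have gaps. The intended case is the union of two disjoint
  intervals, with \<open>a\<close> and \<open>b\<close> the two outer endpoints.\<close>

lemma set_diam_eq_endpoints:
  assumes "order_preserving_metric I \<rho>" "{a..b} \<subseteq> I" "S \<subseteq> {a..b}" "a \<in> S" "b \<in> S"
  shows "set_diam \<rho> S = \<rho> a b"
  unfolding set_diam_def
proof (rule cSup_eq_maximum)
  show "r \<le> \<rho> a b" if "r \<in> {\<rho> u v |u v. u \<in> S \<and> v \<in> S}" for r
    using that assms(3) by (auto intro!: order_preserving_metric_le_endpoints[OF assms(1,2)])
qed (use assms in auto)

lemma le_set_diam:
  assumes "order_preserving_metric I \<rho>" "{a..b} \<subseteq> I" "S \<subseteq> {a..b}" "u \<in> S" "v \<in> S"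
  shows "\<rho> u v \<le> set_diam \<rho> S"
  unfolding set_diam_def
proof (rule cSup_upper)
  show "bdd_above {\<rho> u v |u v. u \<in> S \<and> v \<in> S}"
    using assms(3) by (intro bdd_aboveI[of _ "\<rho> a b"])
      (auto intro!: order_preserving_metric_le_endpoints[OF assms(1,2)])
qed (use assms in auto)

text \<open>Two pairs with the same rank sum would be strictly nested, so that the outer gap would
  exceed the inner span; hence the rank sum is injective on the pairs counted here.\<close>

lemma card_left_critical_pairs_le:
  fixes l u :: "nat \<Rightarrow> real"
  assumes \<rho>: "order_preserving_metric I \<rho>"
    and S: "finite S"
    and lu: "\<And>a. a \<in> S \<Longrightarrow> l a \<le> u a \<and> l a \<in> I \<and> u a \<in> I"
    and sep: "\<And>a b. a \<in> S \<Longrightarrow> b \<in> S \<Longrightarrow> a \<noteq> b \<Longrightarrow> u a < l b \<or> u b < l a"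
  shows "card {(a, b). a \<in> S \<and> b \<in> S \<and> l a < l b \<and> \<rho> (u a) (l b) \<le> \<epsilon> \<and> \<epsilon> < \<rho> (l a) (u b)}
    \<le> 2 * card S" (is "card ?B \<le> _")
proof -
  \<comment> \<open>The position of the interval with index \<open>a\<close> in the left-to-right
    order; \<open>l\<close> is injective on \<open>S\<close> because the intervals are
    separated.\<close>
  define r where "r a = card {b \<in> S. l b < l a}" for a
  have r_less: "r a < r b" if "l a < l b" "a \<in> S" for a b
    unfolding r_def using that S by (intro psubset_card_mono) force+
  have r_bound: "r a < card S" if "a \<in> S" for a
    unfolding r_def using that S by (intro psubset_card_mono) force+
  have l_inj: "a = b" if "a \<in> S" "b \<in> S" "l a = l b" for a b
    using that sep[of a b] lu[of a] lu[of b] by force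
  have l_less: "l a < l b" if "r a < r b" "a \<in> S" "b \<in> S" for a b
    using that r_less[of b a] l_inj[of a b] by (metis less_asym linorder_neqE)
  have gap: "u a < l b" if "a \<in> S" "b \<in> S" "l a < l b" for a b
    using that sep[of a b] lu[of b] lu[of a] by force
  have nested: False
    if "(a, b) \<in> ?B" "(a', b') \<in> ?B" "r a' < r a" "r b < r b'" for a b a' b'
  proof -
    have m: "a \<in> S" "b \<in> S" "a' \<in> S" "b' \<in> S" using that by auto
    have "\<rho> (l a) (u b) \<le> \<rho> (u a') (l b')"
    proof (rule order_preserving_metric_mono[OF \<rho>])
      show "{u a', l a, u b, l b'} \<subseteq> I" using lu m by auto
      show "u a' \<le> l a" "u b \<le> l b'"
        using gap[of a' a] gap[of b b'] l_less[of a' a] l_less[of b b'] that m by auto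
      show "l a \<le> u b" using that(1) lu[of b] by auto
    qed
    then show False using that(1,2) by auto
  qed
  have "inj_on (\<lambda>(a, b). r a + r b) ?B"
  proof (rule inj_onI, clarify)
    fix a b a' b'
    assume B: "a \<in> S" "b \<in> S" "l a < l b" "\<rho> (u a) (l b) \<le> \<epsilon>" "\<epsilon> < \<rho> (l a) (u b)"
      "a' \<in> S" "b' \<in> S" "l a' < l b'" "\<rho> (u a') (l b') \<le> \<epsilon>" "\<epsilon> < \<rho> (l a') (u b')"
      and eq: "r a + r b = r a' + r b'"
    \<comment> \<open>With equal rank sums, a smaller first rank forces a larger second rank, which
      is exactly the strictly nested configuration.\<close>
    have "\<not> r a' < r a" using nested[of a b a' b'] B eq by auto
    moreover have "\<not> r a < r a'" using nested[of a' b' a b] B eq by auto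
    ultimately have "r a = r a'" "r b = r b'" using eq by auto
    then show "a = a' \<and> b = b'" using B r_less l_inj by (metis less_irrefl linorder_neqE)
  qed
  moreover have "(\<lambda>(a, b). r a + r b) ` ?B \<subseteq> {..<2 * card S}"
  proof clarify
    fix a b assume "a \<in> S" "b \<in> S"
    then show "r a + r b < 2 * card S" using r_bound[of a] r_bound[of b] by linarith
  qed
  ultimately show ?thesis
    using card_inj_on_le[of _ ?B "{..<2 * card S}"] by auto
qed

section \<open>Counting pairs of indices\<close>

text \<open>Two distinct indices in a window of length \<open>q\<close> differ by less than
  \<open>q\<close>, so \<open>q\<close> cannot divide their difference.\<close>

lemma inj_on_add_mod:
  fixes q s n :: nat
  shows "inj_on (\<lambda>i. (i + s) mod q) {n..<n + q}"
proof (rule linorder_inj_onI')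
  fix i j assume ij: "i \<in> {n..<n + q}" "j \<in> {n..<n + q}" "i < j"
  show "(i + s) mod q \<noteq> (j + s) mod q"
  proof
    assume "(i + s) mod q = (j + s) mod q"
    then have "q dvd (j + s) - (i + s)" using ij by (metis mod_eq_dvd_iff_nat add_le_mono1 less_imp_le)
    then have "q dvd j - i" by simp
    moreover have "0 < j - i" "j - i < q" using ij by auto
    ultimately show False using nat_dvd_not_less by blast
  qed
qed

text \<open>An injection from \<open>q\<close> indices into \<open>q\<close> residues is a
  bijection.\<close>

lemma card_residue_window:
  fixes q s n a :: nat
  assumes "a < q"
  shows "card {i \<in> {n..<n + q}. (i + s) mod q = a} = 1"
proof -
  have "(\<lambda>i. (i + s) mod q) ` {n..<n + q} = {..<q}"
    using assms by (intro card_subset_eq) (auto simp: card_image inj_on_add_mod)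
  then have "a \<in> (\<lambda>i. (i + s) mod q) ` {n..<n + q}" using assms by simp
  then obtain i where i: "i \<in> {n..<n + q}" "(i + s) mod q = a" by blast
  then have "{i \<in> {n..<n + q}. (i + s) mod q = a} = {i}"
    using inj_on_add_mod[of s q n] unfolding inj_on_def by auto
  then show ?thesis by simp
qed

text \<open>Full windows of length \<open>q\<close> are cut off from the top, each containing
  exactly one index of the class; the remaining fewer than \<open>q\<close> indices contain at most
  one.\<close>

lemma card_residue_bounds:
  fixes q s n a :: nat
  assumes "a < q"
  shows "n div q \<le> card {i. i < n \<and> (i + s) mod q = a} \<and>
    card {i. i < n \<and> (i + s) mod q = a} \<le> n div q + 1"
proof (induction n rule: less_induct)
  case (less n)
  show ?case
  proof (cases "n < q")
    case True
    have "card {i. i < n \<and> (i + s) mod q = a} \<le> card {i \<in> {0..<0 + q}. (i + s) mod q = a}"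
      using True by (intro card_mono) auto
    then show ?thesis using True card_residue_window[OF assms, of 0 s] by simp
  next
    case False
    define k where "k = n - q"
    have n: "n = k + q" "k < n" using False assms by (auto simp: k_def)
    have split: "{i. i < n \<and> (i + s) mod q = a}
        = {i. i < k \<and> (i + s) mod q = a} \<union> {i \<in> {k..<k + q}. (i + s) mod q = a}"
      using n by auto
    have "card {i. i < n \<and> (i + s) mod q = a}
        = card {i. i < k \<and> (i + s) mod q = a} + card {i \<in> {k..<k + q}. (i + s) mod q = a}"
      unfolding split by (rule card_Un_disjoint) auto
    moreover have "n div q = k div q + 1" using n(1) assms by simp
    ultimately show ?thesis using less.IH[OF n(2)] card_residue_window[OF assms, of k s] by linarith
  qed
qed

text \<open>The count differs from \<open>n / q\<close> by at most 1, so the frequency differs from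
  its limit by at most \<open>1 / n\<close>.\<close>

lemma residue_frequency:
  fixes q s a :: nat
  assumes "a < q"
  shows "(\<lambda>n. real (card {i. i < n \<and> (i + s) mod q = a}) / real n) \<longlonglongrightarrow> 1 / real q"
proof -
  let ?c = "\<lambda>n. card {i. i < n \<and> (i + s) mod q = a}"
  have q: "0 < real q" using assms by simp
  have bound: "norm (real (?c n) / real n - 1 / real q) \<le> 1 / real n" if "0 < n" for n
  proof -
    from that have n: "0 < real n" by simp
    have b: "n div q \<le> ?c n" "?c n \<le> n div q + 1" using card_residue_bounds[OF assms, of n s] by auto
    have "real n / real q \<le> real (n div q) + 1" "real (n div q) \<le> real n / real q"
      using q floor_divide_of_nat_eq[of n q, where ?'a = real] by linarith+
    then have "\<bar>real (?c n) - real n / real q\<bar> \<le> 1" using b by linarith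
    moreover have "real (?c n) / real n - 1 / real q = (real (?c n) - real n / real q) / real n"
      using n q by (simp add: field_simps)
    ultimately show ?thesis using n by (simp add: divide_right_mono)
  qed
  have "(\<lambda>n. real (?c n) / real n - 1 / real q) \<longlonglongrightarrow> 0"
    by (rule Lim_null_comparison[OF eventually_mono[OF eventually_gt_at_top[of 0] bound] lim_1_over_n])
  then show ?thesis by (simp add: LIM_zero_iff)
qed

lemma residue_pair_frequency:
  fixes q s :: nat
  assumes A: "A \<subseteq> {..<q} \<times> {..<q}"
  shows "(\<lambda>n. real (card {(i, j). i < n \<and> j < n \<and> ((i + s) mod q, (j + s) mod q) \<in> A}) / (real n)\<^sup>2)
    \<longlonglongrightarrow> real (card A) / (real q)\<^sup>2"
proof -
  define c where "c n a = {i. i < n \<and> (i + s) mod q = a}" for n a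
  have fin: "finite A" using A finite_subset by blast
  have card_eq: "card {(i, j). i < n \<and> j < n \<and> ((i + s) mod q, (j + s) mod q) \<in> A}
      = (\<Sum>(a, b)\<in>A. card (c n a) * card (c n b))" for n
  proof -
    \<comment> \<open>The index pairs with a prescribed pair of residues form a product of two
      residue classes. Hence each element of \<open>A\<close> contributes a product of two
      frequencies, with limit \<open>1 / q\<close> each.\<close>
    have "{(i, j). i < n \<and> j < n \<and> ((i + s) mod q, (j + s) mod q) \<in> A} = (\<Union>z\<in>A. c n (fst z) \<times> c n (snd z))"
      unfolding c_def by force
    also have "card \<dots> = (\<Sum>z\<in>A. card (c n (fst z) \<times> c n (snd z)))"
      by (rule card_UN_disjoint) (use fin in \<open>auto simp: c_def\<close>)
    finally show ?thesis by (simp add: card_cartesian_product case_prod_beta)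
  qed
  have "(\<lambda>n. \<Sum>(a, b)\<in>A. (real (card (c n a)) / real n) * (real (card (c n b)) / real n))
      \<longlonglongrightarrow> (\<Sum>(a, b)\<in>A. (1 / real q) * (1 / real q))"
    unfolding case_prod_beta c_def
    by (intro tendsto_sum tendsto_mult residue_frequency) (use A in auto)
  moreover have "(\<Sum>(a, b)\<in>A. (1 / real q) * (1 / real q)) = real (card A) / (real q)\<^sup>2"
    by (simp add: case_prod_beta power2_eq_square)
  moreover have "(\<Sum>(a, b)\<in>A. (real (card (c n a)) / real n) * (real (card (c n b)) / real n))
      = real (card {(i, j). i < n \<and> j < n \<and> ((i + s) mod q, (j + s) mod q) \<in> A}) / (real n)\<^sup>2" for n
    by (simp add: card_eq case_prod_beta power2_eq_square sum_divide_distrib)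
  ultimately show ?thesis by (simp only:)
qed

section \<open>Asymptotic comparison and a common limit\<close>

text \<open>At most \<open>2 * k * n\<close> of the \<open>n * n\<close> pairs have an index below
  \<open>k\<close>, a vanishing proportion. This disposes of the initial part of an orbit, before it
  has entered a cycle.\<close>

lemma pair_frequency_le_eventually:
  fixes P R :: "nat \<Rightarrow> nat \<Rightarrow> bool"
  assumes imp: "\<And>i j. k \<le> i \<Longrightarrow> k \<le> j \<Longrightarrow> P i j \<Longrightarrow> R i j" and "0 < \<delta>"
  shows "\<forall>\<^sub>F n in sequentially. real (card {(i, j). i < n \<and> j < n \<and> P i j}) / (real n)\<^sup>2
    \<le> real (card {(i, j). i < n \<and> j < n \<and> R i j}) / (real n)\<^sup>2 + \<delta>"
proof -
  have "(\<lambda>n. 2 * real k * (1 / real n)) \<longlonglongrightarrow> 2 * real k * 0"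
    by (intro tendsto_intros lim_1_over_n)
  then have "\<forall>\<^sub>F n in sequentially. 2 * real k * (1 / real n) < \<delta>"
    using \<open>0 < \<delta>\<close> by (simp add: order_tendstoD(2))
  then show ?thesis
  proof (rule eventually_mono[OF eventually_conj[OF _ eventually_gt_at_top[of 0]]])
    fix n assume n: "2 * real k * (1 / real n) < \<delta> \<and> 0 < n"
    let ?P = "{(i, j). i < n \<and> j < n \<and> P i j}" and ?R = "{(i, j). i < n \<and> j < n \<and> R i j}"
    have finR: "finite ?R" by (rule finite_subset[of _ "{..<n} \<times> {..<n}"]) auto
    have "?P \<subseteq> ?R \<union> ({..<k} \<times> {..<n} \<union> {..<n} \<times> {..<k})"
      using imp by (auto simp: not_less)
    then have "card ?P \<le> card (?R \<union> ({..<k} \<times> {..<n} \<union> {..<n} \<times> {..<k}))"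
      using finR by (intro card_mono) auto
    also have "\<dots> \<le> card ?R + (k * n + n * k)"
      by (intro order_trans[OF card_Un_le] add_mono order_refl) (auto simp: card_cartesian_product)
    finally have "real (card ?P) \<le> real (card ?R + (k * n + n * k))" by (rule of_nat_mono)
    then have "real (card ?P) \<le> real (card ?R) + 2 * real k * real n" by simp
    then have "real (card ?P) / (real n)\<^sup>2 \<le> (real (card ?R) + 2 * real k * real n) / (real n)\<^sup>2"
      by (rule divide_right_mono) simp
    also have "\<dots> = real (card ?R) / (real n)\<^sup>2 + 2 * real k * (1 / real n)"
      using n by (simp add: field_simps power2_eq_square)
    finally show "real (card ?P) / (real n)\<^sup>2 \<le> real (card ?R) / (real n)\<^sup>2 + \<delta>" using n by linarith
  qed
qed

text \<open>Every level \<open>t\<close> confines the tail of \<open>C\<close> to a window from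
  \<open>L t\<close> to \<open>U t\<close>, up to arbitrarily small slack. As the windows shrink,
  \<open>C\<close> is Cauchy; its limit lies in every window, which pulls \<open>L\<close> and
  \<open>U\<close> to it.\<close>

lemma common_limit:
  fixes C L U :: "nat \<Rightarrow> real"
  assumes bounds: "\<And>t \<delta>. 0 < \<delta> \<Longrightarrow> \<forall>\<^sub>F n in sequentially. L t - \<delta> \<le> C n \<and> C n \<le> U t + \<delta>"
    and gap: "(\<lambda>t. U t - L t) \<longlonglongrightarrow> 0"
  obtains c where "C \<longlonglongrightarrow> c" "L \<longlonglongrightarrow> c" "U \<longlonglongrightarrow> c"
proof -
  have "Cauchy C"
  proof (rule metric_CauchyI)
    fix e :: real assume "0 < e"
    \<comment> \<open>One third of \<open>e\<close> pays for the window itself, the other two for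
      the slack at its two ends.\<close>
    have "\<forall>\<^sub>F t in sequentially. U t - L t < e / 3"
      by (rule order_tendstoD(2)[OF gap]) (use \<open>0 < e\<close> in simp)
    then obtain t where t: "U t - L t < e / 3" using eventually_happens by force
    obtain M where M: "\<And>n. M \<le> n \<Longrightarrow> L t - e / 3 \<le> C n \<and> C n \<le> U t + e / 3"
      using bounds[of "e / 3" t] \<open>0 < e\<close> unfolding eventually_sequentially by auto
    have "dist (C i) (C j) < e" if "M \<le> i" "M \<le> j" for i j
      using M[OF that(1)] M[OF that(2)] t unfolding dist_real_def by linarith
    then show "\<exists>M. \<forall>i\<ge>M. \<forall>j\<ge>M. dist (C i) (C j) < e" by blast
  qed
  then obtain c where c: "C \<longlonglongrightarrow> c" using Cauchy_convergent convergent_def by blast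
  have L: "L t \<le> c" for t
  proof (rule field_le_epsilon)
    fix \<delta> :: real assume "0 < \<delta>"
    have "L t - \<delta> \<le> c"
      by (rule tendsto_lowerbound[OF c]) (use bounds[OF \<open>0 < \<delta>\<close>, of t] in \<open>auto elim: eventually_mono\<close>)
    then show "L t \<le> c + \<delta>" by simp
  qed
  have U: "c \<le> U t" for t
  proof (rule field_le_epsilon)
    fix \<delta> :: real assume "0 < \<delta>"
    show "c \<le> U t + \<delta>"
      by (rule tendsto_upperbound[OF c]) (use bounds[OF \<open>0 < \<delta>\<close>, of t] in \<open>auto elim: eventually_mono\<close>)
  qed
  have "norm (L t - c) \<le> U t - L t" for t using L[of t] U[of t] by simp
  then have "(\<lambda>t. L t - c) \<longlonglongrightarrow> 0"
    by (intro Lim_null_comparison[OF always_eventually gap]) blast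
  then have "L \<longlonglongrightarrow> c" by (simp add: LIM_zero_iff)
  moreover from tendsto_add[OF gap this] have "U \<longlonglongrightarrow> c" by simp
  ultimately show ?thesis using that c by blast
qed

section \<open>Cycles of intervals\<close>

lemma funpow_self_map:
  assumes "continuous_on I f" "f ` I \<subseteq> I"
  shows "continuous_on I (f ^^ k) \<and> (f ^^ k) ` I \<subseteq> I"
proof (induction k)
  case (Suc k)
  have "continuous_on I (f \<circ> (f ^^ k))"
    using Suc assms by (intro continuous_on_compose) (auto intro: continuous_on_subset)
  then show ?case using Suc assms by (auto simp: o_def)
qed auto

text \<open>One level of the solenoidal structure, with \<open>q\<close> and \<open>J\<close> in the
  roles of \<open>p t\<close> and \<open>J t\<close>. Nondegeneracy is a separate assumption because
  \<open>periodic_interval\<close> admits single points.\<close>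

locale interval_cycle =
  fixes \<rho> :: "real \<Rightarrow> real \<Rightarrow> real" and f :: "real \<Rightarrow> real" and q :: nat and J :: "real set"
  assumes \<rho>: "order_preserving_metric {0..1} \<rho>"
    and cont: "continuous_on {0..1} f"
    and self: "f ` {0..1} \<subseteq> {0..1}"
    and periodic: "periodic_interval {0..1} f q J"
    and nondegenerate: "\<exists>a b. a < b \<and> J = {a..b}"
begin

abbreviation K :: "nat \<Rightarrow> real set" where "K \<equiv> cycle_interval f q J"

lemma metric: "Metric_space {0..1} \<rho>"
  using \<rho> unfolding order_preserving_metric_def by blast

lemma q_pos: "0 < q"
  using periodic unfolding periodic_interval_def by auto

lemma K_mod [simp]: "K (a mod q) = K a"
  by (simp add: cycle_interval_def)

lemma K_mod_add [simp]: "K (a mod q + i) = K (a + i)"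
  by (simp add: cycle_interval_def mod_add_left_eq)

lemma K_add_mod [simp]: "K (i + a mod q) = K (i + a)"
  by (simp add: cycle_interval_def mod_add_right_eq)

lemma image_K: "f ` K a = K (Suc a)"
proof (cases "Suc (a mod q) = q")
  case True
  have "f ` K a = (f ^^ Suc (a mod q)) ` J"
    unfolding cycle_interval_def by (simp add: image_comp o_def)
  also have "\<dots> = J" using True periodic unfolding periodic_interval_def by simp
  finally show ?thesis using True unfolding cycle_interval_def by (simp add: mod_Suc)
next
  case False
  then show ?thesis unfolding cycle_interval_def by (simp add: mod_Suc image_comp o_def)
qed

lemma image_K_funpow: "(f ^^ i) ` K a = K (a + i)"
proof (induction i)
  case (Suc i)
  have "(f ^^ Suc i) ` K a = f ` (f ^^ i) ` K a" by (simp add: image_comp o_def)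
  then show ?case using Suc image_K by simp
qed simp

lemma K_disjoint: "a mod q \<noteq> b mod q \<Longrightarrow> K a \<inter> K b = {}"
  using periodic q_pos unfolding periodic_interval_def cycle_interval_def disjoint_family_on_def
  by auto

text \<open>Compactness and connectedness pass to continuous images. The image is not a point
  because further iteration maps it back onto the nondegenerate \<open>J\<close>.\<close>

lemma K_interval: "\<exists>l u. l < u \<and> 0 \<le> l \<and> u \<le> 1 \<and> K a = {l..u}"
proof -
  obtain c d where cd: "c < d" "J = {c..d}" using nondegenerate by blast
  have J: "J \<subseteq> {0..1}" "(f ^^ q) ` J = J" using periodic unfolding periodic_interval_def by auto
  have fa: "continuous_on {0..1} (f ^^ (a mod q))" "(f ^^ (a mod q)) ` {0..1} \<subseteq> {0..1}"
    using funpow_self_map[OF cont self] by auto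
  have "connected (K a) \<and> compact (K a)" unfolding cycle_interval_def cd(2)
    using J(1) cd(2) by (intro conjI connected_continuous_image compact_continuous_image
        continuous_on_subset[OF fa(1)]) auto
  then obtain l u where K: "K a = {l..u}" using connected_compact_interval_1 by metis
  have sub: "K a \<subseteq> {0..1}" unfolding cycle_interval_def using J(1) fa(2) by blast
  have "K 0 = J" unfolding cycle_interval_def by simp
  \<comment> \<open>The number of further iterates is chosen to complete the cycle.\<close>
  then have "K (a + (q - a mod q)) = J"
    using q_pos unfolding cycle_interval_def
    by (metis mod_add_left_eq le_add_diff_inverse less_imp_le mod_less_divisor mod_self mod_0 funpow_0 image_ident)
  then have eq: "(f ^^ (q - a mod q)) ` {l..u} = {c..d}" using image_K_funpow K cd(2) by metis
  have "l < u"
  proof (rule ccontr)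
    assume "\<not> l < u"
    then have "{l..u} \<subseteq> {l}" by auto
    then have "{c..d} \<subseteq> {(f ^^ (q - a mod q)) l}" using eq by blast
    then show False using cd(1) by (metis atLeastAtMost_iff less_imp_le order_refl singletonD subsetD less_irrefl)
  qed
  moreover from this have "0 \<le> l" "u \<le> 1" using sub K by auto
  ultimately show ?thesis using K by blast
qed

lemma K_subset: "K a \<subseteq> {0..1}"
  using K_interval[of a] by auto

lemma K_nonempty: "K a \<noteq> {}"
  using K_interval[of a] by auto

lemma K_endpoints:
  obtains l u where "\<And>a. l a < u a" "\<And>a. 0 \<le> l a" "\<And>a. u a \<le> 1" "\<And>a. K a = {l a..u a}"
    "\<And>a b. a mod q \<noteq> b mod q \<Longrightarrow> u a < l b \<or> u b < l a"
proof -
  obtain l u where lu: "\<And>a. l a < u a \<and> 0 \<le> l a \<and> u a \<le> 1 \<and> K a = {l a..u a}"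
    using K_interval by metis
  moreover have "u a < l b \<or> u b < l a" if "a mod q \<noteq> b mod q" for a b
  proof (rule ccontr)
    assume "\<not> (u a < l b \<or> u b < l a)"
    \<comment> \<open>Two overlapping intervals share the larger of their left endpoints, so
      disjointness puts one entirely to the left of the other.\<close>
    then have "max (l a) (l b) \<in> K a \<inter> K b" using lu[of a] lu[of b] by auto
    then show False using K_disjoint[OF that] by blast
  qed
  ultimately show ?thesis using that by blast
qed

section \<open>Critical pairs in a cycle\<close>

text \<open>The distance is realised at the inner endpoints and the diameter at the outer ones, and
  these differ since the intervals are nondegenerate. The strictness is what turns
  \<open>diam_m \<le> \<epsilon>\<close> into \<open>dist_m < \<epsilon>\<close>.\<close>

lemma set_dist_less_set_diam:
  assumes "a mod q \<noteq> b mod q"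
  shows "set_dist \<rho> (K a) (K b) < set_diam \<rho> (K a \<union> K b)"
proof -
  obtain l u where lu: "\<And>a. l a < u a" "\<And>a. 0 \<le> l a" "\<And>a. u a \<le> 1" "\<And>a. K a = {l a..u a}"
    "\<And>a b. a mod q \<noteq> b mod q \<Longrightarrow> u a < l b \<or> u b < l a" using K_endpoints by blast
  have *: "set_dist \<rho> (K a) (K b) < set_diam \<rho> (K a \<union> K b)" if "u a < l b" for a b
  proof -
    have bds: "l a < u a" "l b < u b" "0 \<le> l a" "u b \<le> 1" using lu by auto
    have "set_dist \<rho> (K a) (K b) = \<rho> (u a) (l b)" unfolding lu(4)
      using bds that by (intro set_dist_intervals[OF \<rho>]) auto
    also have "\<dots> < \<rho> (l a) (u b)"
      using bds that by (intro order_preserving_metric_strict_mono[OF \<rho>]) auto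
    also have "\<dots> = set_diam \<rho> (K a \<union> K b)" unfolding lu(4)
      using bds that by (intro set_diam_eq_endpoints[OF \<rho>, symmetric]) auto
    finally show ?thesis .
  qed
  show ?thesis using lu(5)[OF assms] *[of a b] *[of b a] set_dist_commute[OF metric]
    by (auto simp: Un_commute)
qed

text \<open>The constant is 2 + 2 + 1: pairs ordered from left to right, their transposes, and the
  diagonal.\<close>

lemma card_critical_pairs_le:
  "card {(a, b). a < q \<and> b < q \<and> set_dist \<rho> (K a) (K b) \<le> \<epsilon> \<and> \<epsilon> < set_diam \<rho> (K a \<union> K b)} \<le> 5 * q"
  (is "card ?B \<le> _")
proof -
  obtain l u where lu: "\<And>a. l a < u a" "\<And>a. 0 \<le> l a" "\<And>a. u a \<le> 1" "\<And>a. K a = {l a..u a}"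
    "\<And>a b. a mod q \<noteq> b mod q \<Longrightarrow> u a < l b \<or> u b < l a" using K_endpoints by blast
  define B where "B = {(a, b). a \<in> {..<q} \<and> b \<in> {..<q} \<and> l a < l b
    \<and> \<rho> (u a) (l b) \<le> \<epsilon> \<and> \<epsilon> < \<rho> (l a) (u b)}"
  have cardB: "card B \<le> 2 * q"
    unfolding B_def using card_left_critical_pairs_le[OF \<rho>, of "{..<q}" l u \<epsilon>] lu
    by (auto simp: less_imp_le order_trans[OF lu(2) less_imp_le[OF lu(1)]]
        order_trans[OF less_imp_le[OF lu(1)] lu(3)])
  have finB: "finite B" unfolding B_def by (rule finite_subset[of _ "{..<q} \<times> {..<q}"]) auto
  have *: "(a, b) \<in> B"
    if "a < q" "b < q" "u a < l b" "set_dist \<rho> (K a) (K b) \<le> \<epsilon>" "\<epsilon> < set_diam \<rho> (K a \<union> K b)" for a b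
  proof -
    have bds: "l a < u a" "l b < u b" "0 \<le> l a" "u b \<le> 1" using lu by auto
    have "set_dist \<rho> (K a) (K b) = \<rho> (u a) (l b)" unfolding lu(4)
      using bds that by (intro set_dist_intervals[OF \<rho>]) auto
    moreover have "\<rho> (l a) (u b) = set_diam \<rho> (K a \<union> K b)" unfolding lu(4)
      using bds that by (intro set_diam_eq_endpoints[OF \<rho>, symmetric]) auto
    ultimately show ?thesis unfolding B_def using that bds by auto
  qed
  have "?B \<subseteq> B \<union> (prod.swap ` B \<union> (\<lambda>a. (a, a)) ` {..<q})"
  proof (rule subrelI)
    fix a b
    assume "(a, b) \<in> ?B"
    then have ab: "a < q" "b < q" "set_dist \<rho> (K a) (K b) \<le> \<epsilon>" "\<epsilon> < set_diam \<rho> (K a \<union> K b)"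
      by auto
    consider "a = b" | "u a < l b" | "u b < l a" using lu(5)[of a b] ab by fastforce
    then show "(a, b) \<in> B \<union> (prod.swap ` B \<union> (\<lambda>a. (a, a)) ` {..<q})"
    proof cases
      case 1
      then show ?thesis using ab by simp
    next
      case 2
      then show ?thesis using * ab by blast
    next
      case 3
      then have "(b, a) \<in> B" using *[of b a] ab set_dist_commute[OF metric] by (simp add: Un_commute)
      then have "(a, b) \<in> prod.swap ` B" by force
      then show ?thesis by blast
    qed
  qed
  then have "card ?B \<le> card (B \<union> (prod.swap ` B \<union> (\<lambda>a. (a, a)) ` {..<q}))"
    using finB by (intro card_mono) auto
  also have "\<dots> \<le> card B + (card (prod.swap ` B) + card ((\<lambda>a. (a, a)) ` {..<q}))"
    by (intro order_trans[OF card_Un_le] add_mono order_refl)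
  also have "\<dots> \<le> 2 * q + (2 * q + q)"
    using cardB card_image_le[OF finB, of prod.swap] card_image_le[of "{..<q}" "\<lambda>a. (a, a)"]
    by (intro add_mono) auto
  finally show ?thesis by simp
qed

text \<open>Shifting both indices by \<open>i\<close> modulo \<open>q\<close> is injective on the
  square of residues and sends the shifted pairs into the unshifted ones.\<close>

lemma card_shifted_pairs_le:
  assumes P: "\<And>a b. P (a mod q) (b mod q) = P a b"
  shows "card {(a, b). a < q \<and> b < q \<and> P (a + i) (b + i)} \<le> card {(a, b). a < q \<and> b < q \<and> P a b}"
    (is "card ?A \<le> card ?B")
proof (rule card_inj_on_le)
  show "inj_on (map_prod (\<lambda>a. (a + i) mod q) (\<lambda>a. (a + i) mod q)) ?A"
    using map_prod_inj_on[OF inj_on_add_mod[of i q 0] inj_on_add_mod[of i q 0]]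
    by (rule inj_on_subset) auto
  show "map_prod (\<lambda>a. (a + i) mod q) (\<lambda>a. (a + i) mod q) ` ?A \<subseteq> ?B"
    using P q_pos by auto
  show "finite ?B" by (rule finite_subset[of _ "{..<q} \<times> {..<q}"]) auto
qed

lemma dist_m_le_iff:
  "0 < m \<Longrightarrow> dist_m \<rho> f q J m a b \<le> \<epsilon> \<longleftrightarrow> (\<forall>i<m. set_dist \<rho> (K (a + i)) (K (b + i)) \<le> \<epsilon>)"
  unfolding dist_m_def by (subst Max_le_iff) auto

lemma dist_m_less_iff:
  "0 < m \<Longrightarrow> dist_m \<rho> f q J m a b < \<epsilon> \<longleftrightarrow> (\<forall>i<m. set_dist \<rho> (K (a + i)) (K (b + i)) < \<epsilon>)"
  unfolding dist_m_def by (subst Max_less_iff) auto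

lemma diam_m_le_iff:
  "0 < m \<Longrightarrow> diam_m \<rho> f q J m a b \<le> \<epsilon> \<longleftrightarrow> (\<forall>i<m. set_diam \<rho> (K (a + i) \<union> K (b + i)) \<le> \<epsilon>)"
  unfolding diam_m_def by (subst Max_le_iff) auto

lemma dist_m_less_if_diam_m_le:
  assumes "0 < m" "0 < \<epsilon>" "diam_m \<rho> f q J m a b \<le> \<epsilon>"
  shows "dist_m \<rho> f q J m a b < \<epsilon>"
  unfolding dist_m_less_iff[OF assms(1)]
proof (intro allI impI)
  fix i assume "i < m"
  then have d: "set_diam \<rho> (K (a + i) \<union> K (b + i)) \<le> \<epsilon>" using assms diam_m_le_iff by blast
  show "set_dist \<rho> (K (a + i)) (K (b + i)) < \<epsilon>"
  \<comment> \<open>If the two shifted intervals coincide, their distance is 0 and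
    \<open>0 < \<epsilon>\<close> decides; otherwise distance is strictly below diameter.\<close>
  proof (cases "(a + i) mod q = (b + i) mod q")
    case True
    then have "K (b + i) = K (a + i)" by (metis K_mod)
    then show ?thesis using set_dist_self[OF metric] K_nonempty K_subset assms(2) by (metis all_not_in_conv)
  next
    case False
    then show ?thesis using set_dist_less_set_diam d by fastforce
  qed
qed

text \<open>The non-strict counterpart of \<open>near_pairs\<close>: a Bowen distance at most
  \<open>\<epsilon>\<close> between orbit points gives only
  \<open>dist_m \<le> \<epsilon>\<close>.\<close>

definition outer_pairs :: "nat \<Rightarrow> real \<Rightarrow> (nat \<times> nat) set" where
  "outer_pairs m \<epsilon> = {(a, b). a < q \<and> b < q \<and> dist_m \<rho> f q J m a b \<le> \<epsilon>}"

lemma card_outer_pairs_le: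
  assumes "0 < m"
  shows "card (outer_pairs m \<epsilon>)
    \<le> card {(a, b). a < q \<and> b < q \<and> diam_m \<rho> f q J m a b \<le> \<epsilon>} + 5 * m * q"
    (is "_ \<le> card ?N + _")
proof -
  define P where "P a b \<longleftrightarrow> set_dist \<rho> (K a) (K b) \<le> \<epsilon> \<and> \<epsilon> < set_diam \<rho> (K a \<union> K b)" for a b
  \<comment> \<open>The pairs that are critical after \<open>i\<close> steps; every outer pair
    violating the diameter condition lies in one of these for some \<open>i < m\<close>.\<close>
  define D where "D i = {(a, b). a < q \<and> b < q \<and> P (a + i) (b + i)}" for i
  have fin: "finite ?N" "finite (D i)" for i
    unfolding D_def by (auto intro: finite_subset[of _ "{..<q} \<times> {..<q}"])
  have cardD: "card (D i) \<le> 5 * q" for i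
    unfolding D_def using card_shifted_pairs_le[of P i] card_critical_pairs_le[of \<epsilon>]
    by (simp add: P_def)
  have "outer_pairs m \<epsilon> \<subseteq> ?N \<union> (\<Union>i<m. D i)"
    unfolding outer_pairs_def D_def P_def dist_m_le_iff[OF assms] diam_m_le_iff[OF assms]
    by (auto simp: not_le)
  then have "card (outer_pairs m \<epsilon>) \<le> card (?N \<union> (\<Union>i<m. D i))"
    using fin by (intro card_mono) auto
  also have "\<dots> \<le> card ?N + (\<Sum>i<m. card (D i))"
    by (intro order_trans[OF card_Un_le] add_mono order_refl card_UN_le) auto
  also have "\<dots> \<le> card ?N + (\<Sum>i<m. 5 * q)" using cardD by (intro add_mono sum_mono) auto
  finally show ?thesis by (simp add: ac_simps)
qed

section \<open>Correlation sums of an orbit inside the cycle\<close>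

lemma bowen_metric_le_iff:
  "0 < m \<Longrightarrow> bowen_metric \<rho> f m ((f ^^ i) x) ((f ^^ j) x) \<le> \<epsilon>
    \<longleftrightarrow> (\<forall>k<m. \<rho> ((f ^^ (i + k)) x) ((f ^^ (j + k)) x) \<le> \<epsilon>)"
  unfolding bowen_metric_def by (subst Max_le_iff) (auto simp: funpow_add add.commute)

text \<open>From time \<open>k\<close> on, the residue of \<open>n + s\<close> modulo
  \<open>q\<close> tells which interval contains the orbit point. The Bowen distance at times
  \<open>i\<close> and \<open>j\<close> therefore lies between \<open>dist_m\<close> and
  \<open>diam_m\<close> of the two residues, and pairs of residues are equidistributed.\<close>

lemma corr_sum_bounds_eventually:
  assumes orbit: "\<And>n. k \<le> n \<Longrightarrow> (f ^^ n) x \<in> K (n + s)"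
    and m: "0 < m" and "0 < \<delta>"
  shows "\<forall>\<^sub>F n in sequentially.
    real (card {(a, b). a < q \<and> b < q \<and> diam_m \<rho> f q J m a b \<le> \<epsilon>}) / (real q)\<^sup>2 - \<delta> \<le> corr_sum \<rho> f m x \<epsilon> n
    \<and> corr_sum \<rho> f m x \<epsilon> n \<le> real (card (outer_pairs m \<epsilon>)) / (real q)\<^sup>2 + \<delta>"
proof -
  let ?N = "{(a, b). a < q \<and> b < q \<and> diam_m \<rho> f q J m a b \<le> \<epsilon>}"
  let ?R = "\<lambda>i j. bowen_metric \<rho> f m ((f ^^ i) x) ((f ^^ j) x) \<le> \<epsilon>"
  let ?in = "\<lambda>A i j. ((i + s) mod q, (j + s) mod q) \<in> A"
  let ?freq = "\<lambda>P n. real (card {(i, j). i < n \<and> j < n \<and> P i j}) / (real n)\<^sup>2"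
  \<comment> \<open>One half covers the convergence of the residue frequencies, the other the pairs
    with an index below \<open>k\<close>.\<close>
  have \<delta>: "0 < \<delta> / 2" using \<open>0 < \<delta>\<close> by simp
  have orb: "(f ^^ (n + i)) x \<in> K ((n + s) mod q + i)" if "k \<le> n" for n i
    using orbit[of "n + i"] that by (simp add: ac_simps)
  have inner: "?R i j" if "k \<le> i" "k \<le> j" "?in ?N i j" for i j
    unfolding bowen_metric_le_iff[OF m]
  proof (intro allI impI)
    fix r assume "r < m"
    then have "set_diam \<rho> (K ((i + s) mod q + r) \<union> K ((j + s) mod q + r)) \<le> \<epsilon>"
      using that(3) diam_m_le_iff[OF m] by auto
    moreover have "\<rho> ((f ^^ (i + r)) x) ((f ^^ (j + r)) x)
        \<le> set_diam \<rho> (K ((i + s) mod q + r) \<union> K ((j + s) mod q + r))"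
      using orb that(1,2) K_subset by (intro le_set_diam[OF \<rho>, of 0 1]) auto
    ultimately show "\<rho> ((f ^^ (i + r)) x) ((f ^^ (j + r)) x) \<le> \<epsilon>" by linarith
  qed
  have outer: "?in (outer_pairs m \<epsilon>) i j" if "k \<le> i" "k \<le> j" "?R i j" for i j
  proof -
    have "set_dist \<rho> (K ((i + s) mod q + r)) (K ((j + s) mod q + r)) \<le> \<epsilon>" if "r < m" for r
    proof -
      have "set_dist \<rho> (K ((i + s) mod q + r)) (K ((j + s) mod q + r))
          \<le> \<rho> ((f ^^ (i + r)) x) ((f ^^ (j + r)) x)"
        by (intro set_dist_le[OF metric] orb \<open>k \<le> i\<close> \<open>k \<le> j\<close>)
      also have "\<dots> \<le> \<epsilon>" using \<open>?R i j\<close> \<open>r < m\<close> unfolding bowen_metric_le_iff[OF m] by blast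
      finally show ?thesis .
    qed
    then show ?thesis unfolding outer_pairs_def using q_pos dist_m_le_iff[OF m] by simp
  qed
  have "(\<lambda>n. ?freq (?in ?N) n) \<longlonglongrightarrow> real (card ?N) / (real q)\<^sup>2"
    by (rule residue_pair_frequency) auto
  then have 1: "\<forall>\<^sub>F n in sequentially. real (card ?N) / (real q)\<^sup>2 - \<delta> / 2 < ?freq (?in ?N) n"
    using \<delta> by (intro order_tendstoD(1)) auto
  have "(\<lambda>n. ?freq (?in (outer_pairs m \<epsilon>)) n) \<longlonglongrightarrow> real (card (outer_pairs m \<epsilon>)) / (real q)\<^sup>2"
    by (rule residue_pair_frequency) (auto simp: outer_pairs_def)
  then have 2: "\<forall>\<^sub>F n in sequentially.
      ?freq (?in (outer_pairs m \<epsilon>)) n < real (card (outer_pairs m \<epsilon>)) / (real q)\<^sup>2 + \<delta> / 2"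
    using \<delta> by (intro order_tendstoD(2)) auto
  have 3: "\<forall>\<^sub>F n in sequentially. ?freq (?in ?N) n \<le> ?freq ?R n + \<delta> / 2"
    by (rule pair_frequency_le_eventually[of k, OF inner \<delta>])
  have 4: "\<forall>\<^sub>F n in sequentially. ?freq ?R n \<le> ?freq (?in (outer_pairs m \<epsilon>)) n + \<delta> / 2"
    by (rule pair_frequency_le_eventually[of k, OF outer \<delta>])
  show ?thesis using 1 2 3 4 unfolding corr_sum_def by eventually_elim linarith
qed

end

section \<open>Solenoidal omega-limit sets\<close>

lemma omega_limit_set_nonempty:
  assumes "compact I" "f ` I \<subseteq> I" "x \<in> I"
  shows "omega_limit_set f x \<noteq> {}"
proof -
  have "(f ^^ n) x \<in> I" for n by (induction n) (use assms in auto)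
  then obtain y r where "strict_mono r" "((\<lambda>n. (f ^^ n) x) \<circ> r) \<longlonglongrightarrow> y"
    using assms(1) unfolding compact_def by metis
  then show ?thesis unfolding omega_limit_set_def o_def by blast
qed

text \<open>Continuity carries a convergent subsequence of the orbit to the subsequence one time
  step later.\<close>

lemma omega_limit_set_invariant:
  assumes "closed I" "continuous_on I f" "f ` I \<subseteq> I" "x \<in> I" "y \<in> omega_limit_set f x"
  shows "f y \<in> omega_limit_set f x"
proof -
  have orb: "(f ^^ n) x \<in> I" for n by (induction n) (use assms in auto)
  obtain r where r: "strict_mono r" "(\<lambda>n. (f ^^ r n) x) \<longlonglongrightarrow> y"
    using assms(5) unfolding omega_limit_set_def by blast
  have "y \<in> I" using closed_sequentially[OF assms(1) _ r(2)] orb by blast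
  then have "(\<lambda>n. f ((f ^^ r n) x)) \<longlonglongrightarrow> f y"
    using orb by (intro continuous_on_tendsto_compose[OF assms(2) r(2)]) auto
  moreover have "strict_mono (\<lambda>n. Suc (r n))" using r(1) by (simp add: strict_mono_def)
  ultimately show ?thesis unfolding omega_limit_set_def
    by (intro CollectI exI[of _ "\<lambda>n. Suc (r n)"]) simp
qed

lemma interval_cycle_solenoidal:
  assumes "order_preserving_metric {0..1} \<rho>" "continuous_on {0..1} f" "f ` {0..1} \<subseteq> {0..1}"
    "solenoidal_witness {0..1} f x p J"
  shows "interval_cycle \<rho> f (p t) (J t)"
  using assms unfolding solenoidal_witness_def by unfold_locales auto

lemma solenoidal_omega_subset:
  assumes "solenoidal_witness I f x p J" "y \<in> omega_limit_set f x"
  shows "\<exists>i<p t. y \<in> cycle_interval f (p t) (J t) i"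
proof -
  have "y \<in> (\<Union>i<p t. (f ^^ i) ` J t)" using assms unfolding solenoidal_witness_def by blast
  then obtain i where "i < p t" "y \<in> (f ^^ i) ` J t" by blast
  then show ?thesis unfolding cycle_interval_def by (intro exI[of _ i]) simp
qed

text \<open>The orbit of any omega-limit point \<open>y\<close> stays in the set and never repeats:
  times \<open>i < j\<close> are separated at a level with more than \<open>j\<close> intervals,
  where the two iterates lie in disjoint intervals.\<close>

lemma infinite_solenoidal_omega:
  assumes "order_preserving_metric {0..1} \<rho>" "continuous_on {0..1} f" "f ` {0..1} \<subseteq> {0..1}"
    "x \<in> {0..1}" and sol: "solenoidal_witness {0..1} f x p J"
  shows "infinite (omega_limit_set f x)"
proof -
  obtain y where y: "y \<in> omega_limit_set f x"
    using omega_limit_set_nonempty[OF _ assms(3,4)] by auto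
  have orb: "(f ^^ i) y \<in> omega_limit_set f x" for i
    by (induction i) (use y omega_limit_set_invariant[OF _ assms(2-4)] in auto)
  have "inj (\<lambda>i. (f ^^ i) y)"
  proof (rule linorder_injI)
    fix i j :: nat assume "i < j"
    have "strict_mono p" using sol unfolding solenoidal_witness_def by blast
    then have "Suc j \<le> p (Suc j)" by (rule strict_mono_imp_increasing)
    then have "j < p (Suc j)" by simp
    then obtain t where t: "j < p t" by blast
    interpret interval_cycle \<rho> f "p t" "J t"
      by (rule interval_cycle_solenoidal[OF assms(1-3) sol])
    obtain a where "y \<in> K a" using solenoidal_omega_subset[OF sol y] by blast
    then have "(f ^^ i) y \<in> K (a + i)" "(f ^^ j) y \<in> K (a + j)" using image_K_funpow by blast+
    moreover have "(a + i) mod p t \<noteq> (a + j) mod p t"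
      using inj_onD[OF inj_on_add_mod[of a "p t" 0], of i j] \<open>i < j\<close> t
      by (auto simp: add.commute)
    ultimately show "(f ^^ i) y \<noteq> (f ^^ j) y" using K_disjoint by force
  qed
  then have "infinite (range (\<lambda>i. (f ^^ i) y))" using range_inj_infinite by blast
  then show ?thesis using orb finite_subset[of "range (\<lambda>i. (f ^^ i) y)"] by blast
qed

text \<open>An infinite omega-limit set inside a finite union of intervals meets one of their
  interiors, which the orbit must therefore enter.\<close>

lemma solenoidal_orbit_in_cycle:
  assumes "order_preserving_metric {0..1} \<rho>" "continuous_on {0..1} f" "f ` {0..1} \<subseteq> {0..1}"
    "x \<in> {0..1}" and sol: "solenoidal_witness {0..1} f x p J"
  obtains k s where "\<And>n. k \<le> n \<Longrightarrow> (f ^^ n) x \<in> cycle_interval f (p t) (J t) (n + s)"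
proof -
  interpret interval_cycle \<rho> f "p t" "J t"
    by (rule interval_cycle_solenoidal[OF assms(1-3) sol])
  obtain l u where lu: "\<And>a. l a < u a" "\<And>a. 0 \<le> l a" "\<And>a. u a \<le> 1" "\<And>a. K a = {l a..u a}"
    using K_endpoints by metis
  have "\<not> omega_limit_set f x \<subseteq> l ` {..<p t} \<union> u ` {..<p t}"
    using infinite_solenoidal_omega[OF assms] finite_subset by blast
  then obtain z where z: "z \<in> omega_limit_set f x" "z \<notin> l ` {..<p t} \<union> u ` {..<p t}" by blast
  obtain i where i: "i < p t" "z \<in> K i" using solenoidal_omega_subset[OF sol z(1)] by blast
  then have "z \<in> {l i<..<u i}" using z(2) lu(4)[of i] by force
  moreover obtain r where r: "(\<lambda>n. (f ^^ r n) x) \<longlonglongrightarrow> z"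
    using z(1) unfolding omega_limit_set_def by blast
  ultimately have "\<forall>\<^sub>F n in sequentially. (f ^^ r n) x \<in> {l i<..<u i}"
    by (intro topological_tendstoD) auto
  then obtain n where "(f ^^ r n) x \<in> {l i<..<u i}" using eventually_happens by force
  then have N: "(f ^^ r n) x \<in> K i" using lu(4)[of i] by auto
  define k where "k = r n"
  show ?thesis
  proof (rule that)
    fix n assume "k \<le> n"
    have "(f ^^ n) x = (f ^^ (n - k)) ((f ^^ k) x)"
      using \<open>k \<le> n\<close> by (metis funpow_add comp_apply le_add_diff_inverse2)
    also have "\<dots> \<in> K (i + (n - k))" using N image_K_funpow unfolding k_def by blast
    \<comment> \<open>Modulo \<open>p t\<close>, the term \<open>(p t - 1) * k\<close> equals
      \<open>- k\<close>; this writes the phase \<open>i - k\<close> as a natural number.\<close>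
    also have "K (i + (n - k)) = K (n + (i + (p t - 1) * k))"
    proof -
      have "n + (i + (p t - 1) * k) = (i + (n - k)) + p t * k"
        using \<open>k \<le> n\<close> q_pos by (cases "p t") auto
      then show ?thesis unfolding cycle_interval_def by (simp only: mod_mult_self2)
    qed
    finally show "(f ^^ n) x \<in> K (n + (i + (p t - 1) * k))" .
  qed
qed

section \<open>Existence and value of the asymptotic correlation sum\<close>

theorem theorem7:
  fixes \<rho> :: "real \<Rightarrow> real \<Rightarrow> real" and f :: "real \<Rightarrow> real" and x \<epsilon> :: real
    and p :: "nat \<Rightarrow> nat" and J :: "nat \<Rightarrow> real set" and m :: nat
  assumes "order_preserving_metric {0..1} \<rho>"
    and "compatible_metric {0..1} \<rho>"
    and "continuous_on {0..1} f"
    and "f ` {0..1} \<subseteq> {0..1}"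
    and "x \<in> {0..1}"
    and "solenoidal_witness {0..1} f x p J"
    and "1 \<le> m"
    and "0 < \<epsilon>"
  shows "lower_corr \<rho> f m x \<epsilon> = upper_corr \<rho> f m x \<epsilon> \<and>
    (\<exists>c. corr_sum \<rho> f m x \<epsilon> \<longlonglongrightarrow> c \<and>
      (\<lambda>t. real (card (inner_pairs \<rho> f p J m t \<epsilon>)) / (real (p t))\<^sup>2) \<longlonglongrightarrow> c \<and>
      (\<lambda>t. real (card (near_pairs \<rho> f p J m t \<epsilon>)) / (real (p t))\<^sup>2) \<longlonglongrightarrow> c)"
proof -
  have cyc: "interval_cycle \<rho> f (p t) (J t)" for t
    by (rule interval_cycle_solenoidal[OF assms(1,3,4,6)])
  have m: "0 < m" using \<open>1 \<le> m\<close> by simp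
  define outer where "outer t = interval_cycle.outer_pairs \<rho> f (p t) (J t) m \<epsilon>" for t
  define L where "L t = real (card (inner_pairs \<rho> f p J m t \<epsilon>)) / (real (p t))\<^sup>2" for t
  define N where "N t = real (card (near_pairs \<rho> f p J m t \<epsilon>)) / (real (p t))\<^sup>2" for t
  define U where "U t = real (card (outer t)) / (real (p t))\<^sup>2" for t
  have sub: "inner_pairs \<rho> f p J m t \<epsilon> \<subseteq> near_pairs \<rho> f p J m t \<epsilon>"
    "near_pairs \<rho> f p J m t \<epsilon> \<subseteq> outer t" "finite (outer t)" for t
  proof -
    interpret interval_cycle \<rho> f "p t" "J t" by (rule cyc)
    show "inner_pairs \<rho> f p J m t \<epsilon> \<subseteq> near_pairs \<rho> f p J m t \<epsilon>"
      unfolding inner_pairs_def near_pairs_def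
      using dist_m_less_if_diam_m_le[OF m \<open>0 < \<epsilon>\<close>] by auto
    show "near_pairs \<rho> f p J m t \<epsilon> \<subseteq> outer t"
      unfolding near_pairs_def outer_def outer_pairs_def by auto
    show "finite (outer t)" unfolding outer_def outer_pairs_def
      by (rule finite_subset[of _ "{..<p t} \<times> {..<p t}"]) auto
  qed
  have LN: "L t \<le> N t" and NU: "N t \<le> U t" for t
    unfolding L_def N_def U_def using sub[of t]
    by (auto intro!: divide_right_mono card_mono dest: finite_subset)
  have "strict_mono p" using assms(6) unfolding solenoidal_witness_def by blast
  \<comment> \<open>Since \<open>p\<close> is strictly increasing, the bound
    \<open>5 * m / p t\<close> on the difference of the two proportions tends to 0.\<close>
  have "(\<lambda>t. 5 * real m * (1 / real (p t))) \<longlonglongrightarrow> 5 * real m * 0"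
    using LIMSEQ_subseq_LIMSEQ[OF lim_1_over_n \<open>strict_mono p\<close>] unfolding o_def
    by (intro tendsto_mult tendsto_const)
  then have lim: "(\<lambda>t. 5 * real m * (1 / real (p t))) \<longlonglongrightarrow> 0" by simp
  have "norm (U t - L t) \<le> 5 * real m * (1 / real (p t))" for t
  proof -
    interpret interval_cycle \<rho> f "p t" "J t" by (rule cyc)
    have "card (outer t) \<le> card (inner_pairs \<rho> f p J m t \<epsilon>) + 5 * m * p t"
      using card_outer_pairs_le[OF m, of \<epsilon>] unfolding outer_def inner_pairs_def .
    then have "real (card (outer t)) - real (card (inner_pairs \<rho> f p J m t \<epsilon>)) \<le> 5 * real m * real (p t)"
      by (simp flip: of_nat_le_iff[where ?'a = real])
    then have "U t - L t \<le> 5 * real m * real (p t) / (real (p t))\<^sup>2"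
      unfolding U_def L_def diff_divide_distrib[symmetric] by (rule divide_right_mono) simp
    also have "\<dots> = 5 * real m * (1 / real (p t))" by (simp add: power2_eq_square)
    finally show ?thesis using LN[of t] NU[of t] by simp
  qed
  then have gap: "(\<lambda>t. U t - L t) \<longlonglongrightarrow> 0"
    by (intro Lim_null_comparison[OF always_eventually lim]) blast
  \<comment> \<open>The entry time \<open>k\<close> and the phase \<open>s\<close> depend on
    \<open>t\<close>, which is harmless because the level is fixed while \<open>n\<close>
    grows.\<close>
  have bounds: "\<forall>\<^sub>F n in sequentially. L t - \<delta> \<le> corr_sum \<rho> f m x \<epsilon> n \<and> corr_sum \<rho> f m x \<epsilon> n \<le> U t + \<delta>"
    if "0 < \<delta>" for t \<delta>
  proof -
    interpret interval_cycle \<rho> f "p t" "J t" by (rule cyc)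
    obtain k s where "\<And>n. k \<le> n \<Longrightarrow> (f ^^ n) x \<in> K (n + s)"
      using solenoidal_orbit_in_cycle[OF assms(1,3-6), where t = t] by blast
    from corr_sum_bounds_eventually[OF this m that] show ?thesis
      unfolding L_def U_def outer_def inner_pairs_def .
  qed
  obtain c where c: "corr_sum \<rho> f m x \<epsilon> \<longlonglongrightarrow> c" "L \<longlonglongrightarrow> c" "U \<longlonglongrightarrow> c"
    using common_limit[OF bounds gap] by blast
  \<comment> \<open>The strict count lies between the inner and the outer one, so its proportion
    inherits their common limit.\<close>
  have "N \<longlonglongrightarrow> c"
    by (rule tendsto_sandwich[OF always_eventually always_eventually c(2,3)]) (use LN NU in auto)
  have "(\<lambda>n. ereal (corr_sum \<rho> f m x \<epsilon> n)) \<longlonglongrightarrow> ereal c" using c(1) by simp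
  then have "lower_corr \<rho> f m x \<epsilon> = upper_corr \<rho> f m x \<epsilon>"
    unfolding lower_corr_def upper_corr_def
    by (metis lim_imp_Liminf lim_imp_Limsup sequentially_bot)
  then show ?thesis using \<open>N \<longlonglongrightarrow> c\<close> c(1,2) unfolding L_def N_def by blast
qed

end
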